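(* Let $m$ be a positive integer and $1\le p<\infty$. Then $\mathcal{W}(2;I^m)$ is $L^p$ dense in $\mathcal{C}(I^m)$; that is, for every $f\in\mathcal{C}(I^m)$ and every $\epsilon>0$ there is $g\in\mathcal{C}(I^m)$ with $\|g\circ g-f\|_p<\epsilon$.
   Context: $I^m=[0,1]^m\subset\mathbb{R}^m$, $\mathcal{C}(I^m)$ is the set of all continuous self-maps of $I^m$, and $\mathcal{W}(2;I^m)=\{g\circ g: g\in\mathcal{C}(I^m)\}$. With $\|(x_1,\dots,x_m)\|_\infty=\max_i|x_i|$ and $\mu$ the Lebesgue measure on $\mathbb{R}^m$, the $L^p$ norm is $\|f\|_p=\left(\int_{I^m}\|f(x)\|_\infty^p\,d\mu(x)\right)^{1/p}$, and distances are measured by $\|f-g\|_p$. *)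

theory Defs
  imports "HOL-Analysis.Analysis"
begin

text \<open>
  The dimension \<open>m\<close> is \<open>CARD('m)\<close> for a finite index type \<open>'m\<close>. Self-maps of the cube are
  represented by total functions on \<open>real ^ 'm\<close> whose values outside the cube are irrelevant.
\<close>

definition cube :: "(real ^ 'm) set" where
  "cube = cbox 0 1"

lemma mem_cube_iff: "x \<in> cube \<longleftrightarrow> (\<forall>i. 0 \<le> x $ i \<and> x $ i \<le> 1)"
  by (simp add: cube_def mem_box_cart)

definition cont_self_maps :: "(real ^ 'm \<Rightarrow> real ^ 'm) set" where
  "cont_self_maps = {f. continuous_on cube f \<and> f \<in> cube \<rightarrow> cube}"

definition iter_squares :: "(real ^ 'm \<Rightarrow> real ^ 'm) set" where
  "iter_squares = {g \<circ> g | g. g \<in> cont_self_maps}"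

lemma infnorm_eq_Max: "infnorm (x :: real ^ 'm) = Max (range (\<lambda>i. \<bar>x $ i\<bar>))"
  by (simp add: infnorm_cart full_SetCompr_eq cSup_eq_Max)

text \<open>
  The Bochner integral is \<open>0\<close> for non-integrable integrands, so \<open>Lp_norm\<close> is meaningful only when
  \<open>infnorm (f x) powr p\<close> is integrable on the cube, as it is for \<open>f\<close> continuous there.
\<close>

definition Lp_norm :: "real \<Rightarrow> (real ^ 'm \<Rightarrow> real ^ 'm) \<Rightarrow> real" where
  "Lp_norm p f = (LINT x:cube|lebesgue. infnorm (f x) powr p) powr (1 / p)"

definition Lp_dense_in ::
  "real \<Rightarrow> (real ^ 'm \<Rightarrow> real ^ 'm) set \<Rightarrow> (real ^ 'm \<Rightarrow> real ^ 'm) set \<Rightarrow> bool" where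
  "Lp_dense_in p W C \<longleftrightarrow>
     W \<subseteq> C \<and> (\<forall>f\<in>C. \<forall>\<epsilon>>0. \<exists>h\<in>W. Lp_norm p (\<lambda>x. h x - f x) < \<epsilon>)"

end

theory Submission
  imports Defs
begin

text \<open>
  Let \<open>g\<close> shrink the cube onto the small corner cube \<open>[0, t/2]^m\<close> and, on that corner, undo the
  shrinking and apply \<open>f\<close>. The two prescriptions conflict only near the corner, so \<open>g\<close> is required
  to be the shrinking map only outside \<open>[0, t)^m\<close> and is completed by the Tietze--Dugundji theorem.
  Then \<open>g \<circ> g = f\<close> outside \<open>[0, t)^m\<close>, a set of measure \<open>t^m\<close>.
\<close>

lemma cont_self_maps_comp:
  assumes "f \<in> cont_self_maps" "g \<in> cont_self_maps"
  shows "f \<circ> g \<in> cont_self_maps"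
  using assms unfolding cont_self_maps_def comp_def
  by (auto intro!: continuous_on_compose2[of cube f cube g])

lemma square_root_off_corner:
  fixes f :: "real ^ 'm \<Rightarrow> real ^ 'm"
  assumes f: "f \<in> cont_self_maps" and t: "0 < t" "t \<le> 1"
  obtains g where "g \<in> cont_self_maps"
    and "\<And>x. x \<in> cube \<Longrightarrow> \<exists>i. t \<le> x $ i \<Longrightarrow> g (g x) = f x"
proof -
  \<comment> \<open>Side \<open>t/2\<close> against the threshold \<open>t\<close> in
    \<open>B\<close> leaves a gap between the two closed sets, so both prescriptions can be imposed
    together continuously.\<close>
  define A :: "(real ^ 'm) set" where "A = cbox 0 (\<chi> i. t/2)"
  define B :: "(real ^ 'm) set" where "B = cube \<inter> (\<Union>i. {x. t \<le> x $ i})"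
  have A_iff: "x \<in> A \<longleftrightarrow> (\<forall>i. 0 \<le> x $ i \<and> x $ i \<le> t/2)" for x
    by (simp add: A_def mem_box_cart)
  define u where "u x = (if x \<in> A then f ((2/t) *\<^sub>R x) else (t/2) *\<^sub>R x)" for x
  have closed: "closed A" "closed B"
    unfolding A_def B_def cube_def
    by (auto intro!: closed_Int closed_Union closed_halfspace_component_ge_cart)
  have disj: "x \<notin> B" if "x \<in> A" for x
  proof
    assume "x \<in> B"
    then obtain i where "t \<le> x $ i" by (auto simp: B_def)
    moreover have "x $ i \<le> t/2" using that by (simp add: A_iff)
    ultimately show False using t by simp
  qed
  have scale: "(2/t) *\<^sub>R x \<in> cube" if "x \<in> A" for x
    unfolding mem_cube_iff
  proof
    fix i
    have "0 \<le> x $ i" "x $ i \<le> t/2" using that by (auto simp: A_iff)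
    then show "0 \<le> ((2/t) *\<^sub>R x) $ i \<and> ((2/t) *\<^sub>R x) $ i \<le> 1"
      using t by (simp add: field_simps)
  qed
  have shrink: "(t/2) *\<^sub>R x \<in> A" if "x \<in> cube" for x
    unfolding A_iff
  proof
    fix i
    have "0 \<le> x $ i" "x $ i \<le> 1" using that by (auto simp: mem_cube_iff)
    then show "0 \<le> ((t/2) *\<^sub>R x) $ i \<and> ((t/2) *\<^sub>R x) $ i \<le> t/2"
      using t by (simp add: mult_left_le)
  qed
  have A_cube: "A \<subseteq> cube"
    unfolding A_def cube_def using t by (subst subset_interval_cart) auto
  have "continuous_on cube f" using f by (simp add: cont_self_maps_def)
  then have cont_f: "continuous_on A (\<lambda>x. f ((2/t) *\<^sub>R x))"
    by (rule continuous_on_compose2) (use scale in \<open>auto intro!: continuous_on_scaleR\<close>)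
  have cont_u: "continuous_on (A \<union> B) u"
    unfolding u_def
  proof (rule continuous_on_cases[OF closed cont_f])
    show "continuous_on B (\<lambda>x. (t/2) *\<^sub>R x)" by (intro continuous_intros)
  \<comment> \<open>The agreement condition on the overlap holds vacuously, since \<open>A\<close>
    and \<open>B\<close> are disjoint.\<close>
  qed (use disj in blast)
  have maps_u: "u ` (A \<union> B) \<subseteq> cube"
  proof (rule image_subsetI)
    fix x assume x: "x \<in> A \<union> B"
    show "u x \<in> cube"
    proof (cases "x \<in> A")
      case True
      then have "f ((2/t) *\<^sub>R x) \<in> cube"
        using f scale[OF True] by (auto simp: cont_self_maps_def)
      then show ?thesis using True by (simp add: u_def)
    next
      case False
      then have "x \<in> cube" using x by (simp add: B_def)
      then have "(t/2) *\<^sub>R x \<in> cube" using shrink A_cube by blast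
      then show ?thesis using False by (simp add: u_def)
    qed
  qed
  have closedin: "closedin (top_of_set cube) (A \<union> B)"
    using closed A_cube by (intro closed_subset) (auto simp: B_def)
  have convex: "convex (cube :: (real ^ 'm) set)" by (simp add: cube_def)
  have "0 \<in> (cube :: (real ^ 'm) set)" by (simp add: mem_cube_iff)
  then have "cube \<noteq> ({} :: (real ^ 'm) set)" by blast
  \<comment> \<open>The extension takes values in the convex set \<open>cube\<close>, so
    \<open>g\<close> is again a self-map.\<close>
  from Dugundji[OF convex this closedin cont_u maps_u] obtain g
    where g: "continuous_on cube g" "g ` cube \<subseteq> cube" "\<And>x. x \<in> A \<union> B \<Longrightarrow> g x = u x"
    by metis
  show thesis
  proof
    show "g \<in> cont_self_maps" using g by (auto simp: cont_self_maps_def)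
    show "g (g x) = f x" if "x \<in> cube" "\<exists>i. t \<le> x $ i" for x
    proof -
      have "x \<in> B" using that by (auto simp: B_def)
      then have "g x = (t/2) *\<^sub>R x" using g(3) disj by (auto simp: u_def)
      \<comment> \<open>By \<open>shrink\<close>, \<open>g x\<close> lies in \<open>A\<close>, so
        the outer \<open>g\<close> uses the first branch of \<open>u\<close>, where the factors
        \<open>2/t\<close> and \<open>t/2\<close> cancel.\<close>
      then show ?thesis using g(3) shrink[OF that(1)] t by (simp add: u_def)
    qed
  qed
qed

text \<open>Controls the error on the corner, where all that is known of the two maps is that their
  values lie in the cube.\<close>

lemma infnorm_diff_cube_le:
  assumes "x \<in> cube" "y \<in> cube"
  shows "infnorm (x - y) \<le> 1"
proof -
  have "\<bar>x $ i - y $ i\<bar> \<le> 1" for i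
    using assms[unfolded mem_cube_iff, rule_format, of i] by linarith
  then show ?thesis by (auto simp: infnorm_eq_Max)
qed

text \<open>The integrand vanishes off the corner and is at most 1 on it, so the integral is at most
  the volume of the corner.\<close>

lemma Lp_norm_le_off_corner:
  fixes f h :: "real ^ 'm \<Rightarrow> real ^ 'm"
  assumes f: "f \<in> cont_self_maps" and h: "h \<in> cont_self_maps" and p: "0 < p"
    and t: "0 \<le> t" "t \<le> 1"
    and eq: "\<And>x. x \<in> cube \<Longrightarrow> \<exists>i. t \<le> x $ i \<Longrightarrow> h x = f x"
  shows "Lp_norm p (\<lambda>x. h x - f x) \<le> t powr (1 / p)"
proof -
  \<comment> \<open>The closed box contains the half-open corner and has the same volume, given by
    the content formula for \<open>cbox\<close>.\<close>
  define Q :: "(real ^ 'm) set" where "Q = cbox 0 (\<chi> i. t)"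
  have le: "indicator cube x *\<^sub>R (infnorm (h x - f x) powr p) \<le> indicator Q x" for x
  proof (cases "x \<in> cube \<and> (\<forall>i. x $ i < t)")
    case True
    then have "x \<in> Q" by (auto simp: Q_def mem_box_cart mem_cube_iff intro: less_imp_le)
    moreover have "infnorm (h x - f x) \<le> 1"
      using True f h by (intro infnorm_diff_cube_le) (auto simp: cont_self_maps_def)
    ultimately show ?thesis
      using True p by (simp add: powr_le1 infnorm_pos_le)
  next
    case False
    then have "x \<notin> cube \<or> h x = f x" using eq by (auto simp: not_less)
    then show ?thesis by (auto simp: infnorm_0)
  qed
  have "(LINT x:cube|lebesgue. infnorm (h x - f x) powr p) \<le> (LINT x|lebesgue. indicator Q x)"
    unfolding set_lebesgue_integral_def
    \<comment> \<open>Integrability is checked for the dominating indicator; a non-integrable left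
      integrand would have integral 0, which also obeys the bound.\<close>
    by (rule integral_mono') (use le in \<open>auto simp: Q_def emeasure_lborel_cbox_eq\<close>)
  also have "\<dots> = t ^ CARD('m)"
    using t by (simp add: Q_def content_cbox_cart interval_ne_empty_cart)
  \<comment> \<open>The dimension is at least 1 and \<open>t\<close> is at most 1, which makes the
    bound independent of the dimension.\<close>
  also have "\<dots> \<le> t"
    using t power_decreasing[of 1 "CARD('m)" t] by simp
  finally show ?thesis
    unfolding Lp_norm_def using p
    by (intro powr_mono2) (auto simp: set_lebesgue_integral_def intro!: integral_nonneg_AE)
qed

theorem theorem5p2:
  fixes p :: real
  assumes "1 \<le> p"
  shows "Lp_dense_in p (iter_squares :: (real ^ 'm \<Rightarrow> real ^ 'm) set) cont_self_maps"
  unfolding Lp_dense_in_def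
proof (intro conjI ballI allI impI)
  show "(iter_squares :: (real ^ 'm \<Rightarrow> real ^ 'm) set) \<subseteq> cont_self_maps"
    by (auto simp: iter_squares_def intro: cont_self_maps_comp)
next
  fix f :: "real ^ 'm \<Rightarrow> real ^ 'm" and \<epsilon> :: real
  assume f: "f \<in> cont_self_maps" and "0 < \<epsilon>"
  \<comment> \<open>The error bound \<open>t powr (1 / p)\<close> is below \<epsilon> once
    \<open>t < \<epsilon> powr p\<close>; halving makes this strict, and the minimum keeps the
    corner inside the cube.\<close>
  define t where "t = min 1 (\<epsilon> powr p / 2)"
  have t: "0 < t" "t \<le> 1" "t < \<epsilon> powr p" using \<open>0 < \<epsilon>\<close> by (auto simp: t_def min_def)
  obtain g where g: "g \<in> cont_self_maps"
    and eq: "\<And>x. x \<in> cube \<Longrightarrow> \<exists>i. t \<le> x $ i \<Longrightarrow> g (g x) = f x"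
    using square_root_off_corner[OF f t(1,2)] by metis
  have "Lp_norm p (\<lambda>x. (g \<circ> g) x - f x) \<le> t powr (1 / p)"
    using assms t eq by (intro Lp_norm_le_off_corner f cont_self_maps_comp g) auto
  also have "\<dots> < (\<epsilon> powr p) powr (1 / p)"
    using assms t by (intro powr_less_mono2) auto
  also have "\<dots> = \<epsilon>"
    using assms \<open>0 < \<epsilon>\<close> by (simp add: powr_powr)
  finally show "\<exists>h\<in>iter_squares. Lp_norm p (\<lambda>x. h x - f x) < \<epsilon>"
    using g by (auto simp: iter_squares_def)
qed

end
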